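(* Consider the bivariate location model with order restriction $\theta_1\le\theta_2$, squared error loss for estimating $\theta_1$, and, for a fixed $\nu\in\mathbb{R}$, the class $\mathcal{D}_{1,\nu}=\{\delta_\alpha:\alpha\in\mathbb{R}\}$ of estimators of $\theta_1$, with $c_{0,1}$, $f_Z$, $\psi_1$, $k_1$, $\alpha_1(\cdot)$ all as defined in the context. Put $\alpha_{1,0}=\alpha_1(0)$ and $\alpha_{1,\infty}=\lim_{\lambda\to\infty}\alpha_1(\lambda)\in[-\infty,\infty]$. (a) Suppose that $\psi_1$ is increasing on $(-\infty,\nu-c_{0,1})$ and that one of the following holds: (i) $f_Z$ is log-concave on $(-\infty,\nu-c_{0,1})$ and, for every $\lambda\ge 0$, $z\mapsto k_1(z,\lambda)$ is increasing on $(-\infty,0)$; or (ii) $f_Z$ is log-convex on $(-\infty,\nu-c_{0,1})$ and, for every $\lambda\ge 0$, $z\mapsto k_1(z,\lambda)$ is decreasing on $(-\infty,0)$. Then the estimators that are admissible within the class $\mathcal{D}_{1,\nu}$ are exactly those $\delta_\alpha$ with $\alpha\in\mathbb{R}$, $\alpha_{1,0}\le\alpha\le\alpha_{1,\infty}$. Moreover, if $-\infty<a<b\le\alpha_{1,0}$ or $\alpha_{1,\infty}\le b<a<\infty$, then $\delta_b$ dominates $\delta_a$, i.e. $R_1(\underline\theta,\delta_b)\le R_1(\underline\theta,\delta_a)$ for all $\underline\theta\in\Theta_0$. (b) Suppose that $\psi_1$ is decreasing on $(-\infty,\nu-c_{0,1})$ and that one of the following holds: (i) $f_Z$ is log-concave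 on $(-\infty,\nu-c_{0,1})$ and, for every $\lambda\ge 0$, $z\mapsto k_1(z,\lambda)$ is decreasing on $(-\infty,0)$; or (ii) $f_Z$ is log-convex on $(-\infty,\nu-c_{0,1})$ and, for every $\lambda\ge 0$, $z\mapsto k_1(z,\lambda)$ is increasing on $(-\infty,0)$. Then the estimators that are admissible within the class $\mathcal{D}_{1,\nu}$ are exactly those $\delta_\alpha$ with $\alpha\in\mathbb{R}$, $\alpha_{1,\infty}\le\alpha\le\alpha_{1,0}$. Moreover, if $-\infty<a<b\le\alpha_{1,\infty}$ or $\alpha_{1,0}\le b<a<\infty$, then $\delta_b$ dominates $\delta_a$, i.e. $R_1(\underline\theta,\delta_b)\le R_1(\underline\theta,\delta_a)$ for all $\underline\theta\in\Theta_0$.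
   Context: Model: $f$ is a fixed Lebesgue probability density on $\mathbb{R}^2$ and $\underline X=(X_1,X_2)$ has density $f(x_1-\theta_1,x_2-\theta_2)$ with unknown $\underline\theta=(\theta_1,\theta_2)\in\Theta_0=\{(t_1,t_2)\in\mathbb{R}^2:t_1\le t_2\}$. Put $\lambda=\theta_2-\theta_1\ge0$, $Z_i=X_i-\theta_i$ ($i=1,2$), $Z=Z_2-Z_1$; the pair $(Z_1,Z_2)$ has density $f$ whatever $\underline\theta$ is. It is assumed that $E[Z_1^2],E[Z_2^2]<\infty$. $c_{0,1}=E[Z_1]$ (so $X_1-c_{0,1}$ is the best location equivariant estimator of $\theta_1$). $\nu\in\mathbb{R}$ is a fixed constant. Estimators: for $\alpha\in\mathbb{R}$, $$\delta_\alpha(\underline X)=\begin{cases}X_1-c_{0,1},&\text{if }X_1-c_{0,1}\le X_2-\nu,\\ \alpha(X_1-c_{0,1})+(1-\alpha)(X_2-\nu),&\text{if }X_1-c_{0,1}>X_2-\nu,\end{cases}$$ and $\mathcal{D}_{1,\nu}=\{\delta_\alpha:\alpha\in\mathbb{R}\}$. Risk: $R_1(\underline\theta,\delta)=E_{\underline\theta}[(\delta(\underline X)-\theta_1)^2]$, $\underline\theta\in\Theta_0$. An estimator $\delta\in\mathcal{D}_{1,\nu}$ is admissible within $\mathcal{D}_{1,\nu}$ if there is no $\delta'\in\mathcal{D}_{1,\nu}$ with $R_1(\underline\theta,\delta')\le R_1(\underline\theta,\delta)$ for all $\underline\theta\in\Theta_0$ and strict inequality for some $\underline\theta\in\Theta_0$.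 Functions: $f_Z(z)=\int_{-\infty}^\infty f(s,s+z)\,ds$ is the density of $Z$; $\psi_1(z)=E[Z_1\mid Z=z]=\int_{-\infty}^\infty s f(s,s+z)\,ds\,/\,\int_{-\infty}^\infty f(s,s+z)\,ds$; it is assumed that $0<f_Z(z)<\infty$ and that $\psi_1(z)$ is well defined (finite) for all $z\in(-\infty,\nu-c_{0,1})$. For $z<0$, $\lambda\ge0$, $$k_1(z,\lambda)=\frac{\psi_1(z+\nu-c_{0,1}-\lambda)-c_{0,1}}{z}.$$ For $\lambda\ge0$, with $I_A$ the indicator of $A$, $$\alpha_1(\lambda)=1+\frac{E[(Z_1-c_{0,1})(Z+\lambda+c_{0,1}-\nu)I_{(-\infty,\nu-c_{0,1}-\lambda)}(Z)]}{E[(Z+\lambda+c_{0,1}-\nu)^2I_{(-\infty,\nu-c_{0,1}-\lambda)}(Z)]}.$$ "Increasing" means non-decreasing and "decreasing" means non-increasing. *)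

theory Defs
  imports "HOL-Probability.Probability"
begin

text \<open>
  Throughout, \<open>f\<close> is a Lebesgue density on the plane and \<open>\<nu>\<close> a real constant.  Since the
  observation is \<open>(Z\<^sub>1 + \<theta>\<^sub>1, Z\<^sub>2 + \<theta>\<^sub>2)\<close> with \<open>(Z\<^sub>1, Z\<^sub>2)\<close> distributed according to \<open>f\<close>, the
  random variables are rendered as coordinate functions on the plane, equipped with the law of
  \<open>(X\<^sub>1, X\<^sub>2)\<close> or that of \<open>(Z\<^sub>1, Z\<^sub>2)\<close>.
\<close>

definition obs_law :: "(real \<times> real \<Rightarrow> real) \<Rightarrow> real \<times> real \<Rightarrow> (real \<times> real) measure" where
  "obs_law f \<theta> = density lborel (\<lambda>x. ennreal (f (fst x - fst \<theta>, snd x - snd \<theta>)))"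

definition noise_law :: "(real \<times> real \<Rightarrow> real) \<Rightarrow> (real \<times> real) measure" where
  "noise_law f = density lborel (\<lambda>z. ennreal (f z))"

definition Theta0 :: "(real \<times> real) set" where
  "Theta0 = {(t1, t2). t1 \<le> t2}"

definition c01 :: "(real \<times> real \<Rightarrow> real) \<Rightarrow> real" where
  "c01 f = (\<integral>z. fst z \<partial>noise_law f)"

definition delta :: "(real \<times> real \<Rightarrow> real) \<Rightarrow> real \<Rightarrow> real \<Rightarrow> real \<times> real \<Rightarrow> real" where
  "delta f \<nu> \<alpha> = (\<lambda>(x1, x2).
     if x1 - c01 f \<le> x2 - \<nu> then x1 - c01 f
     else \<alpha> * (x1 - c01 f) + (1 - \<alpha>) * (x2 - \<nu>))"

definition D1 :: "(real \<times> real \<Rightarrow> real) \<Rightarrow> real \<Rightarrow> (real \<times> real \<Rightarrow> real) set" where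
  "D1 f \<nu> = range (delta f \<nu>)"

text \<open>
  The integrand below is integrable for every estimator in \<open>D1 f \<nu>\<close> once \<open>Z\<^sub>1\<close> and \<open>Z\<^sub>2\<close> have
  finite second moments, so the convention that a non-integrable function has integral 0 plays
  no role.
\<close>

definition R1 :: "(real \<times> real \<Rightarrow> real) \<Rightarrow> real \<times> real \<Rightarrow> (real \<times> real \<Rightarrow> real) \<Rightarrow> real" where
  "R1 f \<theta> d = (\<integral>x. (d x - fst \<theta>)\<^sup>2 \<partial>obs_law f \<theta>)"

definition admissible_within ::
    "(real \<times> real \<Rightarrow> real) \<Rightarrow> (real \<times> real \<Rightarrow> real) set \<Rightarrow> (real \<times> real \<Rightarrow> real) \<Rightarrow> bool" where
  "admissible_within f D d \<longleftrightarrow>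
     d \<in> D \<and>
     \<not> (\<exists>d'\<in>D. (\<forall>\<theta>\<in>Theta0. R1 f \<theta> d' \<le> R1 f \<theta> d) \<and> (\<exists>\<theta>\<in>Theta0. R1 f \<theta> d' < R1 f \<theta> d))"

text \<open>Domination is non-strict: no parameter with strictly smaller risk is required.\<close>

definition dominates ::
    "(real \<times> real \<Rightarrow> real) \<Rightarrow> (real \<times> real \<Rightarrow> real) \<Rightarrow> (real \<times> real \<Rightarrow> real) \<Rightarrow> bool" where
  "dominates f d' d \<longleftrightarrow> (\<forall>\<theta>\<in>Theta0. R1 f \<theta> d' \<le> R1 f \<theta> d)"

definition fZ :: "(real \<times> real \<Rightarrow> real) \<Rightarrow> real \<Rightarrow> real" where
  "fZ f z = (\<integral>s. f (s, s + z) \<partial>lborel)"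

definition psi1 :: "(real \<times> real \<Rightarrow> real) \<Rightarrow> real \<Rightarrow> real" where
  "psi1 f z = (\<integral>s. s * f (s, s + z) \<partial>lborel) / (\<integral>s. f (s, s + z) \<partial>lborel)"

definition k1 :: "(real \<times> real \<Rightarrow> real) \<Rightarrow> real \<Rightarrow> real \<Rightarrow> real \<Rightarrow> real" where
  "k1 f \<nu> z l = (psi1 f (z + \<nu> - c01 f - l) - c01 f) / z"

definition alpha1 :: "(real \<times> real \<Rightarrow> real) \<Rightarrow> real \<Rightarrow> real \<Rightarrow> real" where
  "alpha1 f \<nu> l = 1 +
     (\<integral>z. (fst z - c01 f) * ((snd z - fst z) + l + c01 f - \<nu>)
           * indicator {..<\<nu> - c01 f - l} (snd z - fst z) \<partial>noise_law f)
     / (\<integral>z. ((snd z - fst z) + l + c01 f - \<nu>)\<^sup>2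
           * indicator {..<\<nu> - c01 f - l} (snd z - fst z) \<partial>noise_law f)"

definition alpha1_0 :: "(real \<times> real \<Rightarrow> real) \<Rightarrow> real \<Rightarrow> real" where
  "alpha1_0 f \<nu> = alpha1 f \<nu> 0"

definition alpha1_inf :: "(real \<times> real \<Rightarrow> real) \<Rightarrow> real \<Rightarrow> ereal" where
  "alpha1_inf f \<nu> = Lim at_top (\<lambda>l. ereal (alpha1 f \<nu> l))"

text \<open>Only used on sets where the function is positive.\<close>

definition log_concave_on :: "real set \<Rightarrow> (real \<Rightarrow> real) \<Rightarrow> bool" where
  "log_concave_on S g \<longleftrightarrow> concave_on S (\<lambda>z. ln (g z))"

definition log_convex_on :: "real set \<Rightarrow> (real \<Rightarrow> real) \<Rightarrow> bool" where
  "log_convex_on S g \<longleftrightarrow> convex_on S (\<lambda>z. ln (g z))"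

end

(*
  With lambda = theta_2 - theta_1 and u = min 0 (Z + lambda + c - nu), the loss of delta_alpha is
  (Z_1 - c + (1 - alpha) u)^2, so the risk is a quadratic in alpha with positive leading
  coefficient E[u^2] and minimiser alpha_1(lambda).  Everything therefore follows once alpha_1 is
  continuous (dominated convergence) and monotone: a quadratic is decreased by moving towards its
  minimiser, values of alpha_1 are unique minimisers by the intermediate value theorem, and the
  limit at infinity is handled by passing to the limit in |b - alpha_1(lambda)|.
  For monotonicity, alpha_1(lambda) - 1 is the mean of k_1(., lambda) with respect to the weight
  x^2 f_Z(x + nu - c - lambda) on x < 0.  Log-concavity (log-convexity) of f_Z makes these weights
  have increasing (decreasing) likelihood ratio in lambda, and monotonicity of psi_1 makes
  k_1(x, .) monotone, so a symmetrisation argument as for Chebyshev's sum inequality applies.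
*)

theory Submission
  imports Defs
begin

section \<open>Comparison of weighted means on the line\<close>

text \<open>A Chebyshev-type comparison in two moves: \<open>le\<close> passes from
  \<open>k1\<close> to \<open>k2\<close> under a fixed weight, \<open>sync\<close> passes from
  \<open>g1\<close> to \<open>g2\<close>. The latter says that \<open>k1\<close> and the likelihood
  ratio of \<open>g2\<close> to \<open>g1\<close> vary in the same direction, cross-multiplied to
  avoid division.\<close>

lemma integral_ratio_le:
  fixes g1 g2 k1 k2 :: "real \<Rightarrow> real"
  assumes int: "integrable lborel g1" "integrable lborel g2"
      "integrable lborel (\<lambda>x. k1 x * g1 x)" "integrable lborel (\<lambda>x. k2 x * g2 x)"
    and nonneg: "\<And>x. 0 \<le> g1 x" "\<And>x. 0 \<le> g2 x"
    and pos: "0 < (\<integral>x. g1 x \<partial>lborel)" "0 < (\<integral>x. g2 x \<partial>lborel)"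
    and supp: "\<And>x. x \<notin> S \<Longrightarrow> g1 x = 0" "\<And>x. x \<notin> S \<Longrightarrow> g2 x = 0"
    and le: "\<And>x. x \<in> S \<Longrightarrow> k1 x \<le> k2 x"
    and sync: "\<And>x y. x \<in> S \<Longrightarrow> y \<in> S \<Longrightarrow> x < y \<Longrightarrow>
      0 \<le> (k1 y - k1 x) * (g2 y * g1 x - g2 x * g1 y)"
  shows "(\<integral>x. k1 x * g1 x \<partial>lborel) / (\<integral>x. g1 x \<partial>lborel)
    \<le> (\<integral>x. k2 x * g2 x \<partial>lborel) / (\<integral>x. g2 x \<partial>lborel)"
proof -
  define G1 G2 K1 K2 where "G1 = (\<integral>x. g1 x \<partial>lborel)" and "G2 = (\<integral>x. g2 x \<partial>lborel)"
    and "K1 = (\<integral>x. k1 x * g1 x \<partial>lborel)" and "K2 = (\<integral>x. k2 x * g2 x \<partial>lborel)"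
  \<comment> \<open>The symmetrised integrand; since it is a sum of products, iterated integrals suffice and
    no integrability on the product space is needed.\<close>
  define F where "F x y = (k2 x * g2 x) * g1 y - g2 x * (k1 y * g1 y)
     + g1 x * (k2 y * g2 y) - (k1 x * g1 x) * g2 y" for x y
  have F_nonneg: "0 \<le> F x y" for x y
  proof (cases "x \<in> S \<and> y \<in> S")
    case True
    have sync': "0 \<le> (k1 x - k1 y) * (g2 x * g1 y - g2 y * g1 x)"
    proof -
      consider "x < y" | "x = y" | "y < x" by linarith
      then show ?thesis
      proof cases
        case 1
        then show ?thesis using sync[of x y] True by (simp add: algebra_simps)
      next
        case 3
        then show ?thesis using sync[of y x] True by simp
      qed simp
    qed
    \<comment> \<open>The two right-hand sides add up to \<open>F x y\<close>; lowering
      \<open>k2\<close> to \<open>k1\<close> in each leaves exactly the product in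
      \<open>sync'\<close>.\<close>
    have "(k1 x - k1 y) * (g2 x * g1 y) \<le> (k2 x - k1 y) * (g2 x * g1 y)"
      by (intro mult_right_mono) (use le True nonneg in auto)
    moreover have "(k1 y - k1 x) * (g2 y * g1 x) \<le> (k2 y - k1 x) * (g2 y * g1 x)"
      by (intro mult_right_mono) (use le True nonneg in auto)
    ultimately show ?thesis using sync' unfolding F_def by (simp add: algebra_simps)
  next
    case False
    then have "g1 x = 0 \<and> g2 x = 0 \<or> g1 y = 0 \<and> g2 y = 0" using supp by blast
    then show ?thesis unfolding F_def by auto
  qed
  have "(\<integral>y. F x y \<partial>lborel)
      = (k2 x * g2 x) * G1 - g2 x * K1 + g1 x * K2 - (k1 x * g1 x) * G2" for x
    unfolding F_def G1_def G2_def K1_def K2_def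
    using int by simp
  moreover have "0 \<le> (\<integral>y. F x y \<partial>lborel)" for x
    using F_nonneg by simp
  ultimately have "0 \<le> (\<integral>x. (k2 x * g2 x) * G1 - g2 x * K1 + g1 x * K2 - (k1 x * g1 x) * G2 \<partial>lborel)"
    by (intro integral_nonneg_AE) auto
  also have "\<dots> = 2 * (K2 * G1 - K1 * G2)"
    using int by (simp add: G1_def[symmetric] G2_def[symmetric] K1_def[symmetric] K2_def[symmetric])
  finally have "K1 * G2 \<le> K2 * G1" by simp
  moreover have "0 < G1" "0 < G2" using pos by (simp_all add: G1_def G2_def)
  ultimately have "K1 / G1 \<le> K2 / G2" by (simp add: field_simps)
  then show ?thesis by (simp only: G1_def G2_def K1_def K2_def)
qed

section \<open>Four-point inequalities for log-concave and log-convex functions\<close>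

text \<open>Since \<open>a + d = b + c\<close>, the inner points are convex combinations of
  \<open>a\<close> and \<open>d\<close> with interchanged weights. Adding the two concavity
  inequalities makes the weights sum to one.\<close>

lemma log_concave_on_cross:
  assumes "log_concave_on S g" "\<And>x. x \<in> S \<Longrightarrow> 0 < g x"
    and "a \<in> S" "d \<in> S" "a \<le> b" "b \<le> d" "a + d = b + c"
  shows "g a * g d \<le> g b * g c"
proof (cases "a = d")
  case True
  then show ?thesis using assms by auto
next
  case False
  then have ad: "a < d" using assms by linarith
  define t where "t = (b - a) / (d - a)"
  have t: "0 \<le> t" "t \<le> 1" using assms ad by (auto simp: t_def)
  have conc: "concave_on S (\<lambda>z. ln (g z))" using assms(1) by (simp add: log_concave_on_def)
  have td: "t * (d - a) = b - a" using ad by (simp add: t_def)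
  have b: "b = (1 - t) * a + t * d" using td by (simp add: algebra_simps)
  have c: "c = t * a + (1 - t) * d" using td assms(7) by (simp add: algebra_simps)
  have cv: "convex S" using conc by (simp add: concave_on_iff)
  have bS: "b \<in> S" using cv t assms(3,4) unfolding b convex_alt by simp
  have cS: "c \<in> S" using convexD_alt[OF cv assms(4,3) t] by (simp add: c algebra_simps)
  have "ln (g b) \<ge> (1 - t) * ln (g a) + t * ln (g d)"
    using conc t assms(3,4) unfolding concave_on_iff b
    by (metis (no_types, lifting) diff_add_cancel diff_ge_0_iff_ge real_scaleR_def)
  moreover have "ln (g c) \<ge> t * ln (g a) + (1 - t) * ln (g d)"
    using conc t assms(3,4) unfolding concave_on_iff c
    by (metis (no_types, lifting) add_diff_cancel_left' add_diff_eq diff_ge_0_iff_ge real_scaleR_def add.commute)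
  ultimately have "ln (g a) + ln (g d) \<le> ln (g b) + ln (g c)" by (simp add: algebra_simps)
  then have "ln (g a * g d) \<le> ln (g b * g c)"
    using assms(2) assms(3,4) bS cS by (simp add: ln_mult less_imp_neq[symmetric])
  then show ?thesis
    using assms(2) assms(3,4) bS cS by simp
qed

text \<open>The log-concave version applied to the reciprocal of \<open>g\<close>, whose logarithm
  is the negative of \<open>ln (g z)\<close>.\<close>

lemma log_convex_on_cross:
  assumes "log_convex_on S g" "\<And>x. x \<in> S \<Longrightarrow> 0 < g x"
    and "a \<in> S" "d \<in> S" "a \<le> b" "b \<le> d" "a + d = b + c"
  shows "g b * g c \<le> g a * g d"
proof -
  have "log_concave_on S (\<lambda>z. inverse (g z))"
    using assms(1) by (simp add: log_convex_on_def log_concave_on_def concave_on_def ln_inverse)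
  from log_concave_on_cross[OF this _ assms(3-7)]
  have *: "inverse (g a) * inverse (g d) \<le> inverse (g b) * inverse (g c)"
    using assms(2) by simp
  \<comment> \<open>Undoing the reciprocals needs \<open>g b\<close> and \<open>g c\<close>
    positive, hence \<open>b\<close> and \<open>c\<close> in \<open>S\<close>.\<close>
  have "convex S" using assms(1) by (simp add: log_convex_on_def convex_on_def)
  then have "{a..d} \<subseteq> S" using assms(3,4)
    by (metis closed_segment_eq_real_ivl closed_segment_subset assms(5,6) order_trans)
  then have "b \<in> S" "c \<in> S" using assms(5-7) by auto
  then have "0 < g a * g d" "0 < g b * g c" using assms(2,3,4) by auto
  then show ?thesis using * by (simp flip: inverse_mult_distrib)
qed

section \<open>Change of variables from the pair to its difference\<close>

text \<open>The shear has determinant of modulus one: for fixed \<open>s\<close> it only translates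
  \<open>z\<close>, so Tonelli and translation invariance suffice. Listing \<open>z\<close> first
  makes the difference the outer variable later.\<close>

lemma shear_lborel:
  "distr (lborel \<Otimes>\<^sub>M lborel) (lborel \<Otimes>\<^sub>M lborel) (\<lambda>(z, s). (s, s + z))
    = (lborel \<Otimes>\<^sub>M lborel :: (real \<times> real) measure)"
proof (rule measure_eqI)
  fix A :: "(real \<times> real) set"
  assume "A \<in> sets (distr (lborel \<Otimes>\<^sub>M lborel) (lborel \<Otimes>\<^sub>M lborel) (\<lambda>(z, s). (s, s + z)))"
  then have A[measurable]: "A \<in> sets (lborel \<Otimes>\<^sub>M lborel)" by simp
  have [measurable]: "A \<in> sets (borel \<Otimes>\<^sub>M borel)"
    using A by (simp cong: sets_pair_measure_cong)
  have "emeasure (distr (lborel \<Otimes>\<^sub>M lborel) (lborel \<Otimes>\<^sub>M lborel) (\<lambda>(z, s). (s, s + z))) A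
     = (\<integral>\<^sup>+x. indicator A x \<partial>distr (lborel \<Otimes>\<^sub>M lborel) (lborel \<Otimes>\<^sub>M lborel) (\<lambda>(z, s). (s, s + z)))"
    by simp
  also have "\<dots> = (\<integral>\<^sup>+x. indicator A (case x of (z, s) \<Rightarrow> (s, s + z)) \<partial>(lborel \<Otimes>\<^sub>M lborel))"
    by (subst nn_integral_distr) auto
  also have "\<dots> = (\<integral>\<^sup>+s. \<integral>\<^sup>+z. indicator A (s, s + z) \<partial>lborel \<partial>lborel)"
    by (subst lborel_pair.nn_integral_snd[symmetric]) auto
  also have "\<dots> = (\<integral>\<^sup>+s. \<integral>\<^sup>+z. indicator A (s, z) \<partial>lborel \<partial>lborel)"
  proof (rule nn_integral_cong)
    fix s :: real
    have "(\<integral>\<^sup>+z. indicator A (s, z) \<partial>lborel) = (\<integral>\<^sup>+z. indicator A (s, z) \<partial>distr lborel borel ((+) s))"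
      by (simp add: lborel_distr_plus)
    also have "\<dots> = (\<integral>\<^sup>+z. indicator A (s, s + z) \<partial>lborel)"
      by (subst nn_integral_distr) auto
    finally show "(\<integral>\<^sup>+z. indicator A (s, s + z) \<partial>lborel) = (\<integral>\<^sup>+z. indicator A (s, z) \<partial>lborel)" ..
  qed
  also have "\<dots> = (\<integral>\<^sup>+x. indicator A x \<partial>(lborel \<Otimes>\<^sub>M lborel))"
    by (subst lborel.nn_integral_fst[symmetric]) auto
  finally show "emeasure (distr (lborel \<Otimes>\<^sub>M lborel) (lborel \<Otimes>\<^sub>M lborel) (\<lambda>(z, s). (s, s + z))) A
     = emeasure (lborel \<Otimes>\<^sub>M lborel) A" by simp
qed simp

text \<open>Fubini along the lines on which the second coordinate exceeds the first by
  \<open>z\<close>, the same lines that define \<open>fZ\<close> and \<open>psi1\<close>.\<close>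

lemma shear_integral:
  fixes h :: "real \<times> real \<Rightarrow> real"
  assumes "integrable lborel h"
  shows "integrable lborel (\<lambda>z. \<integral>s. h (s, s + z) \<partial>lborel)"
    and "(\<integral>x. h x \<partial>lborel) = (\<integral>z. (\<integral>s. h (s, s + z) \<partial>lborel) \<partial>lborel)"
proof -
  have h: "integrable (lborel \<Otimes>\<^sub>M lborel) h" using assms by (simp add: lborel_prod)
  have "integrable (distr (lborel \<Otimes>\<^sub>M lborel) (lborel \<Otimes>\<^sub>M lborel) (\<lambda>(z, s). (s, s + z))) h"
    using h by (simp add: shear_lborel)
  then have i: "integrable (lborel \<Otimes>\<^sub>M lborel) (\<lambda>x. h (case x of (z, s) \<Rightarrow> (s, s + z)))"
    using h by (subst (asm) integrable_distr_eq) auto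
  then have i': "integrable (lborel \<Otimes>\<^sub>M lborel) (\<lambda>(z, s). h (s, s + z))"
    by (simp add: case_prod_beta')
  show "integrable lborel (\<lambda>z. \<integral>s. h (s, s + z) \<partial>lborel)"
    using lborel_pair.integrable_fst[OF i'] .
  have "(\<integral>x. h x \<partial>lborel) = (\<integral>x. h x \<partial>distr (lborel \<Otimes>\<^sub>M lborel) (lborel \<Otimes>\<^sub>M lborel) (\<lambda>(z, s). (s, s + z)))"
    by (simp only: shear_lborel) (simp only: lborel_prod)
  also have "\<dots> = (\<integral>x. h (case x of (z, s) \<Rightarrow> (s, s + z)) \<partial>(lborel \<Otimes>\<^sub>M lborel))"
    using h by (subst integral_distr) auto
  also have "\<dots> = (\<integral>z. (\<integral>s. h (s, s + z) \<partial>lborel) \<partial>lborel)"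
    using lborel_pair.integral_fst[OF i'] by (simp add: case_prod_beta')
  finally show "(\<integral>x. h x \<partial>lborel) = (\<integral>z. (\<integral>s. h (s, s + z) \<partial>lborel) \<partial>lborel)" .
qed

section \<open>Monotone targets: limit at infinity and admissibility\<close>

text \<open>\<open>Lim\<close> is a definite description, informative only once convergence is
  known; here the limit is the supremum, which exists in \<open>ereal\<close> even when
  \<open>A\<close> is unbounded.\<close>

lemma mono_on_tendsto_Lim_ereal:
  fixes A :: "real \<Rightarrow> real"
  assumes "mono_on {0..} A"
  defines "L \<equiv> Lim at_top (\<lambda>l. ereal (A l))"
  shows "((\<lambda>l. ereal (A l)) \<longlongrightarrow> L) at_top" and "\<And>l. 0 \<le> l \<Longrightarrow> ereal (A l) \<le> L"
proof -
  \<comment> \<open>Freezing the values at \<open>A 0\<close> for negative arguments makes the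
    function monotone on the whole line without changing it near infinity.\<close>
  define B where "B = (\<lambda>l. ereal (A (max 0 l)))"
  have "mono B" unfolding B_def by (intro monoI) (use assms(1) in \<open>auto simp: mono_on_def\<close>)
  then have B: "(B \<longlongrightarrow> (SUP l. B l)) at_top"
    by (intro increasing_tendsto)
      (auto simp: SUP_upper less_SUP_iff eventually_at_top_linorder, meson monoD order_less_le_trans)
  have ev: "\<forall>\<^sub>F l in at_top. B l = ereal (A l)"
    using eventually_ge_at_top[of 0] by eventually_elim (simp add: B_def)
  from B have *: "((\<lambda>l. ereal (A l)) \<longlongrightarrow> (SUP l. B l)) at_top"
    by (simp add: tendsto_cong[OF ev])
  then have L: "L = (SUP l. B l)" unfolding L_def by (intro tendsto_Lim) auto
  show "((\<lambda>l. ereal (A l)) \<longlongrightarrow> L) at_top" using * L by simp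
  fix l :: real assume "0 \<le> l"
  then have "ereal (A l) = B l" by (simp add: B_def)
  then show "ereal (A l) \<le> L" by (simp add: L SUP_upper)
qed

text \<open>Admissibility for losses that increase strictly with the distance to a moving target
  \<open>A l\<close>, \<open>l \<ge> 0\<close>.\<close>

definition target_admissible :: "(real \<Rightarrow> real) \<Rightarrow> real \<Rightarrow> bool" where
  "target_admissible A a \<longleftrightarrow>
     \<not> (\<exists>b. (\<forall>l\<ge>0. \<bar>b - A l\<bar> \<le> \<bar>a - A l\<bar>) \<and> (\<exists>l\<ge>0. \<bar>b - A l\<bar> < \<bar>a - A l\<bar>))"

text \<open>Reflection preserves distances; this reduces decreasing targets to increasing
  ones.\<close>

lemma target_admissible_uminus:
  "target_admissible (\<lambda>l. - A l) (- a) \<longleftrightarrow> target_admissible A a"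
proof -
  have "\<bar>b + A l\<bar> = \<bar>- b - A l\<bar>" "\<bar>A l - a\<bar> = \<bar>a - A l\<bar>" for b l by linarith+
  then have "(\<exists>b. (\<forall>l\<ge>0. \<bar>b + A l\<bar> \<le> \<bar>A l - a\<bar>) \<and> (\<exists>l\<ge>0. \<bar>b + A l\<bar> < \<bar>A l - a\<bar>))
    \<longleftrightarrow> (\<exists>b. (\<forall>l\<ge>0. \<bar>b - A l\<bar> \<le> \<bar>a - A l\<bar>) \<and> (\<exists>l\<ge>0. \<bar>b - A l\<bar> < \<bar>a - A l\<bar>))"
    by (metis minus_minus)
  then show ?thesis unfolding target_admissible_def by simp
qed

text \<open>Every \<open>A l\<close> lies between \<open>A 0\<close> and the limit, so
  \<open>a\<close> and \<open>b\<close> are on the same side of it and \<open>b\<close> is the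
  nearer one.\<close>

lemma target_closer:
  fixes A :: "real \<Rightarrow> real"
  assumes mono: "mono_on {0..} A"
    and ab: "(a < b \<and> b \<le> A 0) \<or> (Lim at_top (\<lambda>l. ereal (A l)) \<le> ereal b \<and> b < a)"
    and l: "0 \<le> l"
  shows "\<bar>b - A l\<bar> < \<bar>a - A l\<bar>"
proof -
  have "A 0 \<le> A l" using mono l by (auto simp: mono_on_def)
  moreover have "A l \<le> b" if "Lim at_top (\<lambda>l. ereal (A l)) \<le> ereal b"
    using order_trans[OF mono_on_tendsto_Lim_ereal(2)[OF mono l] that] by simp
  ultimately show ?thesis using ab by auto
qed

text \<open>Outside the interval, \<open>A 0\<close> or a point between the limit and
  \<open>a\<close> does better. Inside it, \<open>a\<close> is either a value of \<open>A\<close> or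
  its limit, and in both cases no other point is at least as close throughout.\<close>

lemma target_admissible_iff:
  fixes A :: "real \<Rightarrow> real"
  assumes mono: "mono_on {0..} A" and cont: "continuous_on {0..} A"
  defines "L \<equiv> Lim at_top (\<lambda>l. ereal (A l))"
  shows "target_admissible A a \<longleftrightarrow> A 0 \<le> a \<and> ereal a \<le> L"
proof
  assume adm: "target_admissible A a"
  have no: "\<not> ((a < b \<and> b \<le> A 0) \<or> (L \<le> ereal b \<and> b < a))" for b
  proof
    assume "(a < b \<and> b \<le> A 0) \<or> (L \<le> ereal b \<and> b < a)"
    from target_closer[OF mono this[unfolded L_def]] adm show False
      unfolding target_admissible_def by (metis less_imp_le order_refl)
  qed
  have "ereal a \<le> L"
  proof (rule ccontr)
    assume "\<not> ereal a \<le> L"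
    \<comment> \<open>Density supplies a real competitor directly, without first showing that
      \<open>L\<close> is finite.\<close>
    then obtain b where "L < ereal b" "ereal b < ereal a" using ereal_dense2[of L "ereal a"] by (auto simp: not_le)
    then show False using no[of b] by simp
  qed
  then show "A 0 \<le> a \<and> ereal a \<le> L" using no[of "A 0"] by linarith
next
  assume a: "A 0 \<le> a \<and> ereal a \<le> L"
  note lim = mono_on_tendsto_Lim_ereal(1)[OF mono, folded L_def]
  have "b = a" if b: "\<And>l. 0 \<le> l \<Longrightarrow> \<bar>b - A l\<bar> \<le> \<bar>a - A l\<bar>" for b
  proof (cases "ereal a = L")
    case True
    \<comment> \<open>The limit need not be attained, so the weak inequality is carried to infinity,
      where the right side vanishes.\<close>
    then have A: "(A \<longlongrightarrow> a) at_top" using lim by (metis lim_ereal)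
    have "((\<lambda>l. \<bar>b - A l\<bar>) \<longlongrightarrow> \<bar>b - a\<bar>) at_top" "((\<lambda>l. \<bar>a - A l\<bar>) \<longlongrightarrow> \<bar>a - a\<bar>) at_top"
      by (intro tendsto_intros A)+
    moreover have "\<forall>\<^sub>F l in at_top. \<bar>b - A l\<bar> \<le> \<bar>a - A l\<bar>"
      using eventually_ge_at_top[of 0] by eventually_elim (use b in auto)
    ultimately have "\<bar>b - a\<bar> \<le> \<bar>a - a\<bar>" by (intro tendsto_le[OF trivial_limit_at_top_linorder])
    then show ?thesis by simp
  next
    case False
    \<comment> \<open>This case includes an infinite limit: \<open>A\<close> eventually exceeds
      \<open>a\<close>, hence takes the value \<open>a\<close>, and there the distance from
      \<open>a\<close> is zero.\<close>
    then have "ereal a < L" using a by (simp add: order_less_le)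
    with lim have "\<forall>\<^sub>F l in at_top. ereal a < ereal (A l)" by (rule order_tendstoD)
    then have "\<forall>\<^sub>F l in at_top. 0 \<le> l \<and> a < A l"
      using eventually_ge_at_top[of 0] by eventually_elim auto
    then obtain l where l: "0 \<le> l" "a < A l"
      using eventually_happens'[OF trivial_limit_at_top_linorder] by blast
    have "continuous_on {0..l} A" using cont by (rule continuous_on_subset) auto
    then obtain x where "0 \<le> x" "A x = a" using IVT'[of A 0 a l] a l by auto
    then show ?thesis using b[of x] by simp
  qed
  then show "target_admissible A a" unfolding target_admissible_def by blast
qed

section \<open>The model and its square-integrability\<close>

locale location_model =
  fixes f :: "real \<times> real \<Rightarrow> real" and \<nu> :: real
  assumes f_meas: "f \<in> borel_measurable borel"
    and f_nonneg: "\<And>x. 0 \<le> f x"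
    and f_prob: "prob_space (noise_law f)"
    and moment1: "integrable (noise_law f) (\<lambda>z. (fst z)\<^sup>2)"
    and moment2: "integrable (noise_law f) (\<lambda>z. (snd z)\<^sup>2)"
    and fZ_finite: "\<And>z. z < \<nu> - c01 f \<Longrightarrow> integrable lborel (\<lambda>s. f (s, s + z))"
    and fZ_pos: "\<And>z. z < \<nu> - c01 f \<Longrightarrow> 0 < fZ f z"
    and psi1_finite: "\<And>z. z < \<nu> - c01 f \<Longrightarrow> integrable lborel (\<lambda>s. s * f (s, s + z))"
begin

abbreviation "P \<equiv> noise_law f"
abbreviation "c \<equiv> c01 f"
abbreviation "m \<equiv> \<nu> - c01 f"

text \<open>Clipping at zero, instead of multiplying by an indicator, makes continuity in
  \<open>l\<close> evident.\<close>

definition u :: "real \<Rightarrow> real \<times> real \<Rightarrow> real" where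
  "u l z = min 0 (snd z - fst z + l - m)"

text \<open>\<open>N\<close> and \<open>D\<close> are the numerator and denominator of
  \<open>alpha1 - 1\<close>, and also the coefficients of the risk as a quadratic in
  \<open>1 - \<alpha>\<close>, up to a factor 2 for \<open>N\<close>.\<close>

definition N :: "real \<Rightarrow> real" where "N l = (\<integral>z. (fst z - c) * u l z \<partial>P)"
definition D :: "real \<Rightarrow> real" where "D l = (\<integral>z. (u l z)\<^sup>2 \<partial>P)"

sublocale prob_space P by (rule f_prob)

declare f_meas [measurable]

lemma sets_P [measurable_cong, simp]: "sets P = sets borel"
  by (simp add: noise_law_def)

lemma space_P [simp]: "space P = UNIV" by (simp add: noise_law_def)

lemma measurable_fst_borel [measurable]: "(fst :: real \<times> real \<Rightarrow> real) \<in> borel_measurable borel"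
  and measurable_snd_borel [measurable]: "(snd :: real \<times> real \<Rightarrow> real) \<in> borel_measurable borel"
  by (simp_all add: borel_measurable_continuous_onI continuous_on_fst continuous_on_snd)

lemma u_measurable [measurable]: "u l \<in> borel_measurable borel"
  unfolding u_def by measurable

lemma integrable_square_add:
  assumes [measurable]: "g \<in> borel_measurable P" "h \<in> borel_measurable P"
    and "integrable P (\<lambda>z. (g z)\<^sup>2)" "integrable P (\<lambda>z. (h z)\<^sup>2)"
  shows "integrable P (\<lambda>z. (g z + h z)\<^sup>2 :: real)"
proof (rule Bochner_Integration.integrable_bound)
  show "integrable P (\<lambda>z. 2 * (g z)\<^sup>2 + 2 * (h z)\<^sup>2)" using assms by simp
  show "AE z in P. norm ((g z + h z)\<^sup>2) \<le> norm (2 * (g z)\<^sup>2 + 2 * (h z)\<^sup>2)"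
  proof (rule AE_I2)
    fix z
    have "(g z + h z)\<^sup>2 \<le> 2 * (g z)\<^sup>2 + 2 * (h z)\<^sup>2"
      using zero_le_power2[of "g z - h z"] by (simp add: power2_eq_square algebra_simps)
    then show "norm ((g z + h z)\<^sup>2) \<le> norm (2 * (g z)\<^sup>2 + 2 * (h z)\<^sup>2)" by simp
  qed
qed simp

lemma integrable_mult_of_squares:
  assumes [measurable]: "g \<in> borel_measurable P" "h \<in> borel_measurable P"
    and "integrable P (\<lambda>z. (g z)\<^sup>2)" "integrable P (\<lambda>z. (h z)\<^sup>2)"
  shows "integrable P (\<lambda>z. g z * h z :: real)"
proof (rule Bochner_Integration.integrable_bound)
  show "integrable P (\<lambda>z. (g z)\<^sup>2 + (h z)\<^sup>2)" using assms by simp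
  show "AE z in P. norm (g z * h z) \<le> norm ((g z)\<^sup>2 + (h z)\<^sup>2)"
  proof (rule AE_I2)
    fix z
    have "2 * (\<bar>g z\<bar> * \<bar>h z\<bar>) \<le> (g z)\<^sup>2 + (h z)\<^sup>2"
      using zero_le_power2[of "\<bar>g z\<bar> - \<bar>h z\<bar>"] by (simp add: power2_eq_square algebra_simps)
    moreover have "0 \<le> \<bar>g z\<bar> * \<bar>h z\<bar>" by simp
    ultimately show "norm (g z * h z) \<le> norm ((g z)\<^sup>2 + (h z)\<^sup>2)"
      unfolding real_norm_def abs_mult by linarith
  qed
qed simp

lemma square_int_Z1: "integrable P (\<lambda>z. (fst z - c)\<^sup>2)"
  using integrable_square_add[of fst "\<lambda>_. - c"] moment1 by simp

text \<open>The free constant \<open>B\<close> lets one function dominate \<open>u l\<close> for all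
  \<open>l\<close> in a bounded set.\<close>

lemma square_int_Z: "integrable P (\<lambda>z. (\<bar>snd z - fst z\<bar> + B)\<^sup>2)"
proof -
  have "integrable P (\<lambda>z. (snd z - fst z)\<^sup>2)"
    using integrable_square_add[of snd "\<lambda>z. - fst z"] moment1 moment2 by simp
  then show ?thesis using integrable_square_add[of "\<lambda>z. \<bar>snd z - fst z\<bar>" "\<lambda>_. B"] by simp
qed

lemma abs_u_le: "\<bar>u l z\<bar> \<le> \<bar>snd z - fst z\<bar> + (\<bar>l\<bar> + \<bar>m\<bar>)"
  unfolding u_def by linarith

lemma square_int_u: "integrable P (\<lambda>z. (u l z)\<^sup>2)"
  by (rule Bochner_Integration.integrable_bound[OF square_int_Z[of "\<bar>l\<bar> + \<bar>m\<bar>"]])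
    (use abs_u_le[of l] in \<open>auto intro!: AE_I2 simp flip: abs_le_square_iff\<close>)

lemma int_Z1_u: "integrable P (\<lambda>z. (fst z - c) * u l z)"
  using square_int_Z1 square_int_u by (intro integrable_mult_of_squares) auto

lemma u_alt: "u l z = ((snd z - fst z) + l + c - \<nu>) * indicator {..<\<nu> - c - l} (snd z - fst z)"
  by (auto simp: u_def indicator_def)

lemma alpha1_eq: "alpha1 f \<nu> l = 1 + N l / D l"
proof -
  have "(u l z)\<^sup>2 = ((snd z - fst z) + l + c - \<nu>)\<^sup>2 * indicator {..<\<nu> - c - l} (snd z - fst z)" for z
    by (auto simp: u_alt indicator_def)
  then show ?thesis
    unfolding alpha1_def N_def D_def by (simp add: u_alt mult.assoc)
qed

section \<open>The risk as a quadratic polynomial\<close>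

lemma obs_law_eq: "obs_law f \<theta> = distr P borel ((+) \<theta>)"
proof -
  \<comment> \<open>Writing the density as a function of the shifted point brings it into the form
    that \<open>density_distr\<close> expects.\<close>
  have "distr P borel ((+) \<theta>) = distr (density lborel (\<lambda>z. ennreal (f (\<theta> + z - \<theta>)))) borel ((+) \<theta>)"
    by (simp add: noise_law_def)
  also have "\<dots> = density (distr lborel borel ((+) \<theta>)) (\<lambda>x. ennreal (f (x - \<theta>)))"
    by (intro density_distr[symmetric]) auto
  also have "\<dots> = obs_law f \<theta>"
    by (simp add: lborel_distr_plus obs_law_def minus_prod_def)
  finally show ?thesis ..
qed

lemma R1_eq:
  "R1 f \<theta> (delta f \<nu> \<alpha>) = (\<integral>z. (fst z - c)\<^sup>2 \<partial>P)
     + 2 * (1 - \<alpha>) * N (snd \<theta> - fst \<theta>) + (1 - \<alpha>)\<^sup>2 * D (snd \<theta> - fst \<theta>)"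
proof -
  let ?l = "snd \<theta> - fst \<theta>"
  have [measurable]: "delta f \<nu> \<alpha> \<in> borel_measurable borel"
    unfolding delta_def case_prod_beta' by measurable
  \<comment> \<open>In terms of the noise, \<open>(x2 - \<nu>) - (x1 - c)\<close> equals
    \<open>snd z - fst z + ?l - m\<close>, which is negative exactly on the second branch of
    \<open>delta\<close>.\<close>
  have delta: "delta f \<nu> \<alpha> (\<theta> + z) - fst \<theta> = (fst z - c) + (1 - \<alpha>) * u ?l z" for z
    unfolding delta_def u_def by (auto simp: case_prod_beta' min_def algebra_simps)
  have "R1 f \<theta> (delta f \<nu> \<alpha>) = (\<integral>z. (delta f \<nu> \<alpha> (\<theta> + z) - fst \<theta>)\<^sup>2 \<partial>P)"
    unfolding R1_def obs_law_eq by (subst integral_distr) auto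
  also have "\<dots> = (\<integral>z. (fst z - c)\<^sup>2 + 2 * (1 - \<alpha>) * ((fst z - c) * u ?l z) + (1 - \<alpha>)\<^sup>2 * (u ?l z)\<^sup>2 \<partial>P)"
    unfolding delta by (intro Bochner_Integration.integral_cong) (auto simp: power2_eq_square algebra_simps)
  also have "\<dots> = (\<integral>z. (fst z - c)\<^sup>2 \<partial>P) + 2 * (1 - \<alpha>) * N ?l + (1 - \<alpha>)\<^sup>2 * D ?l"
    unfolding N_def D_def
    using square_int_Z1 int_Z1_u square_int_u by simp
  finally show ?thesis .
qed

section \<open>One-dimensional integrals for the coefficients\<close>

text \<open>The variable \<open>x\<close> stands for \<open>Z + l - m\<close>, so the support
  \<open>x < 0\<close> no longer depends on \<open>l\<close> and weights for different
  \<open>l\<close> can be compared pointwise.\<close>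

definition weight :: "real \<Rightarrow> real \<Rightarrow> real" where
  "weight l x = indicator {..<0} x * (x\<^sup>2 * fZ f (x + m - l))"

lemma weight_eq_0: "\<not> x < 0 \<Longrightarrow> weight l x = 0"
  by (simp add: weight_def)

text \<open>The inner integral is the conditional expectation of \<open>h\<close> given
  \<open>Z = z\<close>, not yet divided by the density of \<open>Z\<close>.\<close>

lemma noise_integral:
  assumes [measurable]: "h \<in> borel_measurable borel" and "integrable P h"
  shows "integrable lborel (\<lambda>z. \<integral>s. f (s, s + z) * h (s, s + z) \<partial>lborel)"
    and "(\<integral>x. h x \<partial>P) = (\<integral>z. (\<integral>s. f (s, s + z) * h (s, s + z) \<partial>lborel) \<partial>lborel)"
proof -
  have i: "integrable lborel (\<lambda>x. f x * h x)"
    using assms(2) f_nonneg unfolding noise_law_def by (subst (asm) integrable_density) auto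
  show "integrable lborel (\<lambda>z. \<integral>s. f (s, s + z) * h (s, s + z) \<partial>lborel)"
    using shear_integral(1)[OF i] .
  have "(\<integral>x. h x \<partial>P) = (\<integral>x. f x * h x \<partial>lborel)"
    using f_nonneg unfolding noise_law_def by (subst integral_density) auto
  then show "(\<integral>x. h x \<partial>P) = (\<integral>z. (\<integral>s. f (s, s + z) * h (s, s + z) \<partial>lborel) \<partial>lborel)"
    using shear_integral(2)[OF i] by simp
qed

lemma D_eq:
  shows "integrable lborel (weight l)" and "D l = (\<integral>x. weight l x \<partial>lborel)"
proof -
  \<comment> \<open>On the fibre over \<open>m - l + x\<close> the function \<open>u l\<close> is
    the constant \<open>min 0 x\<close>, leaving the integral that defines
    \<open>fZ\<close>.\<close>
  have eq: "(\<integral>s. f (s, s + (m - l + x)) * (u l (s, s + (m - l + x)))\<^sup>2 \<partial>lborel) = weight l x" for x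
    by (auto simp: u_def weight_def fZ_def indicator_def algebra_simps)
  note I = noise_integral[OF _ square_int_u[of l]]
  show "integrable lborel (weight l)"
    using lborel_integrable_real_affine[OF I(1), of 1 "m - l"] by (simp add: eq)
  show "D l = (\<integral>x. weight l x \<partial>lborel)"
    using lborel_integral_real_affine[of 1 "\<lambda>z. \<integral>s. f (s, s + z) * (u l (s, s + z))\<^sup>2 \<partial>lborel" "m - l"]
    by (simp add: D_def I(2) eq)
qed

lemma N_eq:
  assumes "0 \<le> l"
  shows "integrable lborel (\<lambda>x. k1 f \<nu> x l * weight l x)"
    and "N l = (\<integral>x. k1 f \<nu> x l * weight l x \<partial>lborel)"
proof -
  have eq: "(\<integral>s. f (s, s + (m - l + x)) * ((fst (s, s + (m - l + x)) - c) * u l (s, s + (m - l + x))) \<partial>lborel)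
      = k1 f \<nu> x l * weight l x" for x
  proof (cases "x < 0")
    case True
    let ?z = "m - l + x"
    \<comment> \<open>This is where \<open>0 \<le> l\<close> enters: the fibre lies in the range
      where \<open>fZ\<close> is positive and the integrals behind \<open>fZ\<close> and
      \<open>psi1\<close> exist.\<close>
    have z: "?z < m" using True assms by linarith
    have "(\<integral>s. f (s, s + ?z) * ((fst (s, s + ?z) - c) * u l (s, s + ?z)) \<partial>lborel)
      = (\<integral>s. x * (s * f (s, s + ?z) - c * f (s, s + ?z)) \<partial>lborel)"
      using True by (intro Bochner_Integration.integral_cong) (auto simp: u_def algebra_simps)
    also have "\<dots> = x * (psi1 f ?z * fZ f ?z - c * fZ f ?z)"
      using fZ_finite[OF z] psi1_finite[OF z] fZ_pos[OF z]
      by (simp add: psi1_def fZ_def)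
    also have "\<dots> = k1 f \<nu> x l * weight l x"
      using True by (simp add: k1_def weight_def power2_eq_square field_simps)
    finally show ?thesis .
  next
    case False
    then show ?thesis by (simp add: u_def weight_def)
  qed
  note I = noise_integral[OF _ int_Z1_u[of l]]
  show "integrable lborel (\<lambda>x. k1 f \<nu> x l * weight l x)"
    using lborel_integrable_real_affine[OF I(1), of 1 "m - l"] by (simp add: eq[simplified])
  show "N l = (\<integral>x. k1 f \<nu> x l * weight l x \<partial>lborel)"
    using lborel_integral_real_affine[of 1 "\<lambda>z. \<integral>s. f (s, s + z) * ((s - c) * u l (s, s + z)) \<partial>lborel" "m - l"]
    by (simp add: N_def I(2) eq[simplified])
qed

lemma weight_nonneg: "0 \<le> l \<Longrightarrow> 0 \<le> weight l x"
  using fZ_pos[of "x + m - l"] by (auto simp: weight_def indicator_def)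

text \<open>A vanishing integral would force the weight to be zero almost everywhere, yet it is
  nonzero at every negative point.\<close>

lemma D_pos:
  assumes "0 \<le> l"
  shows "0 < D l"
proof -
  have "D l \<noteq> 0"
  proof
    assume "D l = 0"
    then have "AE x in lborel. weight l x = 0"
      using D_eq[of l] weight_nonneg[OF assms] by (simp add: integral_nonneg_eq_0_iff_AE)
    moreover have "weight l x \<noteq> 0" if "x < 0" for x
      using that fZ_pos[of "x + m - l"] assms by (simp add: weight_def)
    ultimately have "AE x in lborel. x \<notin> {-1<..<0::real}" by (auto elim!: eventually_mono)
    then have "emeasure lborel {-1<..<0::real} = 0"
      by (subst (asm) AE_iff_measurable[where N="{-1<..<0::real}"]) auto
    then show False by simp
  qed
  moreover have "0 \<le> D l" unfolding D_def by simp
  ultimately show ?thesis by simp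
qed

section \<open>Risk comparison as distance to a target\<close>

text \<open>Completing the square; the terms free of the coefficient cancel in the
  difference.\<close>

lemma R1_diff:
  assumes "\<theta> \<in> Theta0"
  defines "l \<equiv> snd \<theta> - fst \<theta>"
  shows "R1 f \<theta> (delta f \<nu> b) - R1 f \<theta> (delta f \<nu> a)
    = D l * ((b - alpha1 f \<nu> l)\<^sup>2 - (a - alpha1 f \<nu> l)\<^sup>2)"
proof -
  have "0 \<le> l" using assms by (auto simp: Theta0_def)
  then have "D l \<noteq> 0" using D_pos by fastforce
  then have N: "N l = D l * (alpha1 f \<nu> l - 1)" by (simp add: alpha1_eq)
  show ?thesis unfolding R1_eq l_def[symmetric] N by (simp add: power2_eq_square algebra_simps)
qed

lemma R1_le_iff:
  assumes "\<theta> \<in> Theta0"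
  defines "l \<equiv> snd \<theta> - fst \<theta>"
  shows "R1 f \<theta> (delta f \<nu> b) \<le> R1 f \<theta> (delta f \<nu> a)
    \<longleftrightarrow> \<bar>b - alpha1 f \<nu> l\<bar> \<le> \<bar>a - alpha1 f \<nu> l\<bar>"
proof -
  have "0 \<le> l" using assms by (auto simp: Theta0_def)
  then have "0 < D l" by (rule D_pos)
  then have "D l * ((b - alpha1 f \<nu> l)\<^sup>2 - (a - alpha1 f \<nu> l)\<^sup>2) \<le> 0
     \<longleftrightarrow> \<bar>b - alpha1 f \<nu> l\<bar> \<le> \<bar>a - alpha1 f \<nu> l\<bar>"
    by (simp add: mult_le_0_iff abs_le_square_iff)
  then show ?thesis
    using R1_diff[OF assms(1), of b a] unfolding l_def by linarith
qed

text \<open>The risk difference depends on the parameter only through \<open>l\<close>, and each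
  \<open>l \<ge> 0\<close> is realised by \<open>(0, l)\<close>.\<close>

lemma dominates_iff:
  "dominates f (delta f \<nu> b) (delta f \<nu> a)
    \<longleftrightarrow> (\<forall>l\<ge>0. \<bar>b - alpha1 f \<nu> l\<bar> \<le> \<bar>a - alpha1 f \<nu> l\<bar>)" (is "?L \<longleftrightarrow> ?R")
proof
  assume ?L
  show ?R
  proof (intro allI impI)
    fix l :: real assume "0 \<le> l"
    then have "(0, l) \<in> Theta0" by (simp add: Theta0_def)
    then show "\<bar>b - alpha1 f \<nu> l\<bar> \<le> \<bar>a - alpha1 f \<nu> l\<bar>"
      using \<open>?L\<close> R1_le_iff[of "(0, l)" b a] by (simp add: dominates_def)
  qed
next
  assume ?R
  then show ?L by (auto simp: dominates_def R1_le_iff) (auto simp: Theta0_def)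
qed

lemma admissible_within_iff:
  "admissible_within f (D1 f \<nu>) (delta f \<nu> a) \<longleftrightarrow> target_admissible (alpha1 f \<nu>) a"
proof -
  \<comment> \<open>Strict improvement somewhere is the failure of the reverse non-strict
    domination, so \<open>dominates_iff\<close> covers both clauses of admissibility.\<close>
  have "(\<exists>\<theta>\<in>Theta0. R1 f \<theta> (delta f \<nu> b) < R1 f \<theta> (delta f \<nu> a))
      \<longleftrightarrow> \<not> dominates f (delta f \<nu> a) (delta f \<nu> b)" for b
    by (auto simp: dominates_def not_le)
  then have "(\<exists>\<theta>\<in>Theta0. R1 f \<theta> (delta f \<nu> b) < R1 f \<theta> (delta f \<nu> a))
      \<longleftrightarrow> (\<exists>l\<ge>0. \<bar>b - alpha1 f \<nu> l\<bar> < \<bar>a - alpha1 f \<nu> l\<bar>)" for b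
    by (auto simp: dominates_iff not_le)
  then show ?thesis
    unfolding admissible_within_def target_admissible_def D1_def dominates_iff[symmetric]
    by (auto simp: dominates_def)
qed

lemma admissible_set_eq:
  "{d. admissible_within f (D1 f \<nu>) d} = {delta f \<nu> a |a. target_admissible (alpha1 f \<nu>) a}"
  using admissible_within_iff by (auto simp: admissible_within_def D1_def)

section \<open>Continuity of \<open>alpha1\<close>\<close>

lemma tendsto_u: "(L \<longlongrightarrow> l) F \<Longrightarrow> ((\<lambda>n. u (L n) z) \<longlongrightarrow> u l z) F"
  unfolding u_def by (intro tendsto_intros)

lemma tendsto_N_D:
  assumes L: "L \<longlonglongrightarrow> l"
  shows "(\<lambda>n. N (L n)) \<longlonglongrightarrow> N l" "(\<lambda>n. D (L n)) \<longlonglongrightarrow> D l"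
proof -
  \<comment> \<open>A convergent sequence is bounded, which yields dominating functions independent
    of \<open>n\<close>.\<close>
  obtain B where B: "\<And>n. \<bar>L n\<bar> \<le> B"
    using convergent_imp_Bseq[OF convergentI[OF L]] by (auto simp: Bseq_def)
  have ub: "\<bar>u (L n) z\<bar> \<le> \<bar>snd z - fst z\<bar> + (B + \<bar>m\<bar>)" for n z
    using abs_u_le[of "L n" z] B[of n] by linarith
  let ?w = "\<lambda>z. \<bar>snd z - fst z\<bar> + (B + \<bar>m\<bar>)"
  have int: "integrable P (\<lambda>z. \<bar>fst z - c\<bar> * ?w z)"
    by (rule integrable_mult_of_squares) (use square_int_Z1 square_int_Z in auto)
  show "(\<lambda>n. N (L n)) \<longlonglongrightarrow> N l"
    unfolding N_def
    by (rule integral_dominated_convergence[where w = "\<lambda>z. \<bar>fst z - c\<bar> * ?w z"])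
      (auto intro!: int AE_I2 tendsto_mult tendsto_u L mult_left_mono ub simp: abs_mult)
  have "(u (L n) z)\<^sup>2 \<le> (?w z)\<^sup>2" for n z
    using ub[of n z] by (simp flip: abs_le_square_iff)
  then show "(\<lambda>n. D (L n)) \<longlonglongrightarrow> D l"
    unfolding D_def
    by (intro integral_dominated_convergence[where w = "\<lambda>z. (?w z)\<^sup>2"])
      (auto intro!: square_int_Z AE_I2 tendsto_power tendsto_u L)
qed

lemma continuous_alpha1: "continuous_on {0..} (alpha1 f \<nu>)"
proof (rule continuous_on_sequentiallyI)
  fix L :: "nat \<Rightarrow> real" and l
  assume "\<forall>n. L n \<in> {0..}" "l \<in> {0..}" "L \<longlonglongrightarrow> l"
  then show "(\<lambda>n. alpha1 f \<nu> (L n)) \<longlonglongrightarrow> alpha1 f \<nu> l"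
    unfolding alpha1_eq using D_pos[of l] by (intro tendsto_intros tendsto_N_D) auto
qed

section \<open>Monotonicity of \<open>alpha1\<close>\<close>

text \<open>The monotone likelihood ratio of the weights. The arguments \<open>x + m - l'\<close>
  and \<open>y + m - l\<close> are the outer pair, \<open>y + m - l'\<close> and
  \<open>x + m - l\<close> the inner pair with the same sum; the squares are common to both
  sides.\<close>

lemma weight_cross:
  assumes "0 \<le> l" "l \<le> l'" "x < y" "y < 0"
  shows "log_concave_on {..<m} (fZ f) \<Longrightarrow> weight l' x * weight l y \<le> weight l' y * weight l x"
    and "log_convex_on {..<m} (fZ f) \<Longrightarrow> weight l' y * weight l x \<le> weight l' x * weight l y"
proof -
  let ?p = "\<lambda>x l. fZ f (x + m - l)"
  have w: "weight l' x * weight l y = (x\<^sup>2 * y\<^sup>2) * (?p x l' * ?p y l)"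
    "weight l' y * weight l x = (x\<^sup>2 * y\<^sup>2) * (?p y l' * ?p x l)"
    using assms by (simp_all add: weight_def)
  show "weight l' x * weight l y \<le> weight l' y * weight l x"
    if "log_concave_on {..<m} (fZ f)"
    unfolding w by (intro mult_left_mono log_concave_on_cross[OF that]) (use assms fZ_pos in auto)
  show "weight l' y * weight l x \<le> weight l' x * weight l y"
    if "log_convex_on {..<m} (fZ f)"
    unfolding w by (intro mult_left_mono log_convex_on_cross[OF that]) (use assms fZ_pos in auto)
qed

text \<open>No order between \<open>l\<close> and \<open>l'\<close> is imposed, so the same
  comparison serves the decreasing case with the roles exchanged.\<close>

lemma alpha1_le:
  assumes l: "0 \<le> l" "0 \<le> l'"
    and le: "\<And>x. x < 0 \<Longrightarrow> k1 f \<nu> x l \<le> k1 f \<nu> x l'"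
    and sync: "\<And>x y. x < y \<Longrightarrow> y < 0 \<Longrightarrow> 0 \<le> (k1 f \<nu> y l - k1 f \<nu> x l) *
      (weight l' y * weight l x - weight l' x * weight l y)"
  shows "alpha1 f \<nu> l \<le> alpha1 f \<nu> l'"
proof -
  have "N l / D l \<le> N l' / D l'"
    unfolding N_eq(2)[OF l(1)] N_eq(2)[OF l(2)] D_eq(2)[of l] D_eq(2)[of l']
  proof (rule integral_ratio_le[where S = "{..<0}"])
    show "0 < (\<integral>x. weight l x \<partial>lborel)" "0 < (\<integral>x. weight l' x \<partial>lborel)"
      using D_pos[OF l(1)] D_pos[OF l(2)] D_eq(2)[of l] D_eq(2)[of l'] by simp_all
  qed (use l le sync in \<open>auto intro: D_eq(1) N_eq(1) weight_nonneg simp: weight_eq_0\<close>)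
  then show ?thesis by (simp add: alpha1_eq)
qed

lemma mono_alpha1:
  assumes psi: "mono_on {..<m} (psi1 f)"
    and shape: "(log_concave_on {..<m} (fZ f) \<and> (\<forall>l\<ge>0. mono_on {..<0} (\<lambda>z. k1 f \<nu> z l))) \<or>
      (log_convex_on {..<m} (fZ f) \<and> (\<forall>l\<ge>0. antimono_on {..<0} (\<lambda>z. k1 f \<nu> z l)))"
  shows "mono_on {0..} (alpha1 f \<nu>)"
proof (rule mono_onI)
  fix l l' :: real assume l: "l \<in> {0..}" "l' \<in> {0..}" "l \<le> l'"
  show "alpha1 f \<nu> l \<le> alpha1 f \<nu> l'"
  proof (rule alpha1_le)
    fix x :: real assume x: "x < 0"
    \<comment> \<open>Raising \<open>l\<close> lowers the argument of \<open>psi1\<close>; dividing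
      by the negative \<open>x\<close> then reverses the inequality.\<close>
    then have "psi1 f (x + \<nu> - c - l') \<le> psi1 f (x + \<nu> - c - l)"
      using l by (intro mono_onD[OF psi]) auto
    then show "k1 f \<nu> x l \<le> k1 f \<nu> x l'" using x by (simp add: k1_def divide_right_mono_neg)
  next
    fix x y :: real assume xy: "x < y" "y < 0"
    show "0 \<le> (k1 f \<nu> y l - k1 f \<nu> x l) * (weight l' y * weight l x - weight l' x * weight l y)"
      \<comment> \<open>Both factors are nonnegative in the log-concave case and both nonpositive in
        the log-convex case.\<close>
      using shape
    proof
      assume "log_concave_on {..<m} (fZ f) \<and> (\<forall>l\<ge>0. mono_on {..<0} (\<lambda>z. k1 f \<nu> z l))"
      then have "k1 f \<nu> x l \<le> k1 f \<nu> y l" "weight l' x * weight l y \<le> weight l' y * weight l x"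
        using xy l weight_cross(1)[of l l' x y] by (auto simp: monotone_on_def)
      then show ?thesis by simp
    next
      assume "log_convex_on {..<m} (fZ f) \<and> (\<forall>l\<ge>0. antimono_on {..<0} (\<lambda>z. k1 f \<nu> z l))"
      then have "k1 f \<nu> y l \<le> k1 f \<nu> x l" "weight l' y * weight l x \<le> weight l' x * weight l y"
        using xy l weight_cross(2)[of l l' x y] by (auto simp: monotone_on_def)
      then show ?thesis by (intro mult_nonpos_nonpos) auto
    qed
  qed (use l in auto)
qed

text \<open>Stated for the negated function so that the results on increasing targets apply as they
  stand.\<close>

lemma antimono_alpha1:
  assumes psi: "antimono_on {..<m} (psi1 f)"
    and shape: "(log_concave_on {..<m} (fZ f) \<and> (\<forall>l\<ge>0. antimono_on {..<0} (\<lambda>z. k1 f \<nu> z l))) \<or>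
      (log_convex_on {..<m} (fZ f) \<and> (\<forall>l\<ge>0. mono_on {..<0} (\<lambda>z. k1 f \<nu> z l)))"
  shows "mono_on {0..} (\<lambda>l. - alpha1 f \<nu> l)"
proof (rule mono_onI)
  fix l l' :: real assume l: "l \<in> {0..}" "l' \<in> {0..}" "l \<le> l'"
  have "alpha1 f \<nu> l' \<le> alpha1 f \<nu> l"
  proof (rule alpha1_le)
    fix x :: real assume x: "x < 0"
    then have "psi1 f (x + \<nu> - c - l) \<le> psi1 f (x + \<nu> - c - l')"
      using l by (intro monotone_onD[OF psi]) auto
    then show "k1 f \<nu> x l' \<le> k1 f \<nu> x l" using x by (simp add: k1_def divide_right_mono_neg)
  next
    fix x y :: real assume xy: "x < y" "y < 0"
    show "0 \<le> (k1 f \<nu> y l' - k1 f \<nu> x l') * (weight l y * weight l' x - weight l x * weight l' y)"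
      using shape
    proof
      assume "log_concave_on {..<m} (fZ f) \<and> (\<forall>l\<ge>0. antimono_on {..<0} (\<lambda>z. k1 f \<nu> z l))"
      then have "k1 f \<nu> y l' \<le> k1 f \<nu> x l'" "weight l' x * weight l y \<le> weight l' y * weight l x"
        using xy l weight_cross(1)[of l l' x y] by (auto simp: monotone_on_def)
      then show ?thesis by (intro mult_nonpos_nonpos) (auto simp: mult.commute)
    next
      assume "log_convex_on {..<m} (fZ f) \<and> (\<forall>l\<ge>0. mono_on {..<0} (\<lambda>z. k1 f \<nu> z l))"
      then have "k1 f \<nu> x l' \<le> k1 f \<nu> y l'" "weight l' y * weight l x \<le> weight l' x * weight l y"
        using xy l weight_cross(2)[of l l' x y] by (auto simp: monotone_on_def)
      then show ?thesis by (intro mult_nonneg_nonneg) (auto simp: mult.commute)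
    qed
  qed (use l in auto)
  then show "- alpha1 f \<nu> l \<le> - alpha1 f \<nu> l'" by simp
qed

section \<open>Admissible estimators and domination\<close>

lemma increasing_case:
  assumes mono: "mono_on {0..} (alpha1 f \<nu>)"
  shows "((\<lambda>l. ereal (alpha1 f \<nu> l)) \<longlongrightarrow> alpha1_inf f \<nu>) at_top"
    and "{d. admissible_within f (D1 f \<nu>) d} =
            {delta f \<nu> \<alpha> |\<alpha>. alpha1_0 f \<nu> \<le> \<alpha> \<and> ereal \<alpha> \<le> alpha1_inf f \<nu>}"
    and "(a < b \<and> b \<le> alpha1_0 f \<nu>) \<or> (alpha1_inf f \<nu> \<le> ereal b \<and> b < a)
           \<Longrightarrow> dominates f (delta f \<nu> b) (delta f \<nu> a)"
proof -
  show "((\<lambda>l. ereal (alpha1 f \<nu> l)) \<longlongrightarrow> alpha1_inf f \<nu>) at_top"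
    unfolding alpha1_inf_def by (rule mono_on_tendsto_Lim_ereal[OF mono])
  show "{d. admissible_within f (D1 f \<nu>) d} =
            {delta f \<nu> \<alpha> |\<alpha>. alpha1_0 f \<nu> \<le> \<alpha> \<and> ereal \<alpha> \<le> alpha1_inf f \<nu>}"
    unfolding admissible_set_eq target_admissible_iff[OF mono continuous_alpha1]
      alpha1_inf_def alpha1_0_def ..
  show "dominates f (delta f \<nu> b) (delta f \<nu> a)"
    if "(a < b \<and> b \<le> alpha1_0 f \<nu>) \<or> (alpha1_inf f \<nu> \<le> ereal b \<and> b < a)"
    unfolding dominates_iff
    using target_closer[OF mono that[unfolded alpha1_inf_def alpha1_0_def]] by (auto intro: less_imp_le)
qed

text \<open>Reflection of the increasing case: negation exchanges the two ends of the admissible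
  interval, and its upper end for the negated target is \<open>- alpha1_inf f \<nu>\<close>.\<close>

lemma decreasing_case:
  assumes mono: "mono_on {0..} (\<lambda>l. - alpha1 f \<nu> l)"
  shows "((\<lambda>l. ereal (alpha1 f \<nu> l)) \<longlongrightarrow> alpha1_inf f \<nu>) at_top"
    and "{d. admissible_within f (D1 f \<nu>) d} =
            {delta f \<nu> \<alpha> |\<alpha>. alpha1_inf f \<nu> \<le> ereal \<alpha> \<and> \<alpha> \<le> alpha1_0 f \<nu>}"
    and "(a < b \<and> ereal b \<le> alpha1_inf f \<nu>) \<or> (alpha1_0 f \<nu> \<le> b \<and> b < a)
           \<Longrightarrow> dominates f (delta f \<nu> b) (delta f \<nu> a)"
proof -
  have "((\<lambda>l. - ereal (- alpha1 f \<nu> l)) \<longlongrightarrow> - Lim at_top (\<lambda>l. ereal (- alpha1 f \<nu> l))) at_top"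
    by (intro tendsto_uminus_ereal mono_on_tendsto_Lim_ereal[OF mono])
  then have lim: "((\<lambda>l. ereal (alpha1 f \<nu> l)) \<longlongrightarrow> - Lim at_top (\<lambda>l. ereal (- alpha1 f \<nu> l))) at_top"
    by simp
  then have inf: "alpha1_inf f \<nu> = - Lim at_top (\<lambda>l. ereal (- alpha1 f \<nu> l))"
    unfolding alpha1_inf_def by (intro tendsto_Lim) auto
  then show "((\<lambda>l. ereal (alpha1 f \<nu> l)) \<longlongrightarrow> alpha1_inf f \<nu>) at_top"
    using lim by simp
  have neg: "Lim at_top (\<lambda>l. ereal (- alpha1 f \<nu> l)) = - alpha1_inf f \<nu>"
    using inf by simp
  have uminus_le: "ereal (- a) \<le> - L \<longleftrightarrow> L \<le> ereal a" "- L \<le> ereal (- a) \<longleftrightarrow> ereal a \<le> L" for a L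
    by (cases L; auto)+
  have "target_admissible (alpha1 f \<nu>) a \<longleftrightarrow> alpha1_inf f \<nu> \<le> ereal a \<and> a \<le> alpha1_0 f \<nu>" for a
    using target_admissible_iff[OF mono continuous_on_minus[OF continuous_alpha1], of "- a"]
    unfolding neg uminus_le target_admissible_uminus alpha1_0_def by auto
  then show "{d. admissible_within f (D1 f \<nu>) d} =
            {delta f \<nu> \<alpha> |\<alpha>. alpha1_inf f \<nu> \<le> ereal \<alpha> \<and> \<alpha> \<le> alpha1_0 f \<nu>}"
    unfolding admissible_set_eq by simp
  show "dominates f (delta f \<nu> b) (delta f \<nu> a)"
    if ab: "(a < b \<and> ereal b \<le> alpha1_inf f \<nu>) \<or> (alpha1_0 f \<nu> \<le> b \<and> b < a)"
    unfolding dominates_iff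
  proof (intro allI impI)
    fix l :: real assume l: "0 \<le> l"
    \<comment> \<open>Under reflection the two alternatives for \<open>a\<close> and
      \<open>b\<close> change places.\<close>
    have "(- a < - b \<and> - b \<le> - alpha1 f \<nu> 0) \<or>
        (Lim at_top (\<lambda>l. ereal (- alpha1 f \<nu> l)) \<le> ereal (- b) \<and> - b < - a)"
      using ab unfolding neg uminus_le alpha1_0_def by auto
    from target_closer[OF mono this l] show "\<bar>b - alpha1 f \<nu> l\<bar> \<le> \<bar>a - alpha1 f \<nu> l\<bar>" by linarith
  qed
qed

end

theorem theorem3p1p1:
  fixes f :: "real \<times> real \<Rightarrow> real" and \<nu> :: real
  assumes f_meas: "f \<in> borel_measurable borel"
    and f_nonneg: "\<And>x. 0 \<le> f x"
    and f_prob: "prob_space (noise_law f)"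
    and moment1: "integrable (noise_law f) (\<lambda>z. (fst z)\<^sup>2)"
    and moment2: "integrable (noise_law f) (\<lambda>z. (snd z)\<^sup>2)"
    and fZ_finite: "\<And>z. z < \<nu> - c01 f \<Longrightarrow> integrable lborel (\<lambda>s. f (s, s + z))"
    and fZ_pos: "\<And>z. z < \<nu> - c01 f \<Longrightarrow> 0 < fZ f z"
    and psi1_finite: "\<And>z. z < \<nu> - c01 f \<Longrightarrow> integrable lborel (\<lambda>s. s * f (s, s + z))"
  shows "(mono_on {..<\<nu> - c01 f} (psi1 f) \<and>
          ((log_concave_on {..<\<nu> - c01 f} (fZ f) \<and>
              (\<forall>l\<ge>0. mono_on {..<0} (\<lambda>z. k1 f \<nu> z l))) \<or>
           (log_convex_on {..<\<nu> - c01 f} (fZ f) \<and>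
              (\<forall>l\<ge>0. antimono_on {..<0} (\<lambda>z. k1 f \<nu> z l))))
          \<longrightarrow>
          ((\<lambda>l. ereal (alpha1 f \<nu> l)) \<longlongrightarrow> alpha1_inf f \<nu>) at_top \<and>
          {d. admissible_within f (D1 f \<nu>) d} =
            {delta f \<nu> \<alpha> |\<alpha>. alpha1_0 f \<nu> \<le> \<alpha> \<and> ereal \<alpha> \<le> alpha1_inf f \<nu>} \<and>
          (\<forall>a b. (a < b \<and> b \<le> alpha1_0 f \<nu>) \<or> (alpha1_inf f \<nu> \<le> ereal b \<and> b < a)
             \<longrightarrow> dominates f (delta f \<nu> b) (delta f \<nu> a)))
       \<and>
         (antimono_on {..<\<nu> - c01 f} (psi1 f) \<and>
          ((log_concave_on {..<\<nu> - c01 f} (fZ f) \<and>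
              (\<forall>l\<ge>0. antimono_on {..<0} (\<lambda>z. k1 f \<nu> z l))) \<or>
           (log_convex_on {..<\<nu> - c01 f} (fZ f) \<and>
              (\<forall>l\<ge>0. mono_on {..<0} (\<lambda>z. k1 f \<nu> z l))))
          \<longrightarrow>
          ((\<lambda>l. ereal (alpha1 f \<nu> l)) \<longlongrightarrow> alpha1_inf f \<nu>) at_top \<and>
          {d. admissible_within f (D1 f \<nu>) d} =
            {delta f \<nu> \<alpha> |\<alpha>. alpha1_inf f \<nu> \<le> ereal \<alpha> \<and> \<alpha> \<le> alpha1_0 f \<nu>} \<and>
          (\<forall>a b. (a < b \<and> ereal b \<le> alpha1_inf f \<nu>) \<or> (alpha1_0 f \<nu> \<le> b \<and> b < a)
             \<longrightarrow> dominates f (delta f \<nu> b) (delta f \<nu> a)))"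
proof -
  interpret location_model f \<nu>
    using assms by (rule location_model.intro)
  show ?thesis
    using increasing_case[OF mono_alpha1] decreasing_case[OF antimono_alpha1] by blast
qed

end
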